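(* Let $\mathcal{N}(G,\mathcal{A})$ be an $n$-ary network with $|V(G)|=q$ nodes, with total ordering $(a=a_1,a_2,\dots,a_q=b)$ of its nodes, such that $a$ is the source and $b$ is the sink, and with activation tensors $\mathcal{A}=\{A_1,\dots,A_q\}$, where $A_i$ is the activation tensor of $a_i$. Let $T_1,\dots,T_q$ be the order-$q$ tensors of size $n\times\cdots\times n$ obtained from $A_1,\dots,A_q$ by the expansion procedure (forget, blow, forget) described in the context. Then the Bhattacharya–Mesner product $\circ(T_1,\dots,T_q)$ is equal to the total tensor $N$ of the network.
   Context: All tensors have complex entries, and every index ranges over $\{0,1,\dots,n-1\}$. An order-$d$ tensor of size $n\times\cdots\times n$ is an element $T\in(\mathbb{C}^n)^{\otimes d}$, identified with its array of entries $T_{i_1,\dots,i_d}$. **Network.** An $n$-ary network $\mathcal{N}(G,\mathcal{A})$ consists of: (i) a finite directed graph $G=(V(G),E(G))$ without oriented cycles; (ii) a total ordering $(a_1,\dots,a_q)$ of the nodes compatible with the graph, i.e. if there is an arrow $a_k\to a_i$ in $E(G)$ then $k<i$; (iii) for each node $a_i$ an activation tensor $A_i$, which is an arbitrary tensor in $(\mathbb{C}^n)^{\otimes(p_i+1)}$, where $p_i$ is the in-degree of $a_i$ (the number of its parents; $a_k$ is a parent of $a_i$ if $a_k\to a_i\in E(G)$). No stochastic normalization is required. The node $a_1$ is called the source and $a_q$ the sink (just the first and last nodes in the total ordering). Write $P_i=\{k : a_k \text{ is a parent of } a_i\}\subset\{1,\dots,i-1\}$, so $|P_i|=p_i$. The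 first $p_i$ indices of $A_i$ correspond to the parents of $a_i$ in increasing order, and the last index corresponds to the state of $a_i$. **Total tensor.** The total tensor of the network is the order-$q$ tensor $N$ of size $n\times\cdots\times n$ with $$N_{i_1,\dots,i_q}=\prod_{j=1}^q (A_j)_{i_{k_1},\dots,i_{k_{p_j}},\,i_j},\qquad \text{where } P_j=\{k_1<\cdots<k_{p_j}\}.$$ **Bhattacharya–Mesner product (BMP).** For order-$d$ tensors $T_1,\dots,T_d$ of size $n\times\cdots\times n$, $\circ(T_1,\dots,T_d)$ is the order-$d$ tensor of size $n\times\cdots\times n$ with $$\circ(T_1,\dots,T_d)_{i_1,\dots,i_d}=\sum_{h=0}^{n-1}(T_d)_{h,i_2,\dots,i_d}\,(T_1)_{i_1,h,i_3,\dots,i_d}\cdots(T_{d-1})_{i_1,i_2,\dots,i_{d-1},h},$$ i.e. in $T_k$ with $1\le k\le d-1$ the index in position $k+1$ is replaced by $h$, and in $T_d$ the index in position $1$ is replaced by $h$. In the trivial case $d=1$ of a single vector, $\circ(T_1)$ is understood to be $T_1$. **Blow.** For an order-$d$ tensor $T$, the blow $b(T)$ is the order-$(d+1)$ tensor with $(b(T))_{i_1,\dots,i_{d+1}}=T_{i_1,\dots,i_d}$ if $i_1=i_{d+1}$, and $0$ otherwise. **Forget.** For an order-$d$ tensor $T$, an integer $d'\ge d$ and a subset $J\subset\{1,\dots,d'\}$ with $|J|=d'-d$, the forget $f_J(T)$ is the order-$d'$ tensor with $(f_J(T))_{i_1,\dots,i_{d'}}=T_{j_1,\dots,j_d}$,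 where $(j_1,\dots,j_d)$ is obtained from $(i_1,\dots,i_{d'})$ by erasing the entries $i_k$ for all $k\in J$. If $J=\emptyset$ then $f_J(T)=T$. **Expansion procedure.** For each node $a_i$ the order-$q$ tensor $T_i$ is defined as follows. Step 1: start with the activation tensor $A_i$, of order $p_i+1$. Step 2: if $i>1$, let $A_i'=f_J(A_i)$, of order $i$, where $J=\{1,\dots,i-1\}\setminus P_i$; if $i=1$, let $A_1'=A_1$. Step 3: if $i\ne q$, let $A_i''=b(A_i')$, of order $i+1$; if $i=q$, let $A_q''=A_q'$. Step 4: let $T_i=f_H(A_i'')$, of order $q$, where $H=\{i+2,\dots,q\}$ (empty if $i\ge q-1$). *)

theory Defs
  imports Complex_Main "HOL-Library.FuncSet" "Graph_Theory.Pair_Digraph"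
begin

section \<open>Tensors\<close>

text \<open>
  The index \<open>(i\<^sub>1, \<dots>, i\<^sub>d)\<close> is the list \<open>[i\<^sub>1, \<dots>, i\<^sub>d]\<close>. Positions are counted from 1 in the
  mathematics and from 0 by the list functions: \<open>i\<^sub>k\<close> is \<open>xs ! (k - 1)\<close>.
  Tensors are extensional, so that equality in \<open>tensors n d\<close> is equality of all entries.
\<close>

type_synonym tensor = "nat list \<Rightarrow> complex"

definition indices :: "nat \<Rightarrow> nat \<Rightarrow> nat list set" where
  "indices n d = {xs. set xs \<subseteq> {..<n} \<and> length xs = d}"

definition tensors :: "nat \<Rightarrow> nat \<Rightarrow> tensor set" where
  "tensors n d = (indices n d \<rightarrow>\<^sub>E UNIV)"

text \<open>
  Replacing the entry in position \<open>k + 1\<close> by \<open>h\<close> is \<open>xs[k := h]\<close>, and replacing the entry in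
  position 1 is \<open>xs[0 := h]\<close>. The factors are \<open>T 1, \<dots>, T d\<close>.
\<close>

definition bmp :: "nat \<Rightarrow> nat \<Rightarrow> (nat \<Rightarrow> tensor) \<Rightarrow> tensor" where
  "bmp n d T =
     (if d = 1 then T 1
      else restrict (\<lambda>xs. \<Sum>h<n. T d (xs[0 := h]) * (\<Prod>k = 1..d - 1. T k (xs[k := h])))
             (indices n d))"

text \<open>\<open>d\<close> is the order of the argument; the result has order \<open>d + 1\<close>.\<close>

definition blow :: "nat \<Rightarrow> nat \<Rightarrow> tensor \<Rightarrow> tensor" where
  "blow n d T =
     restrict (\<lambda>xs. if xs ! 0 = xs ! d then T (take d xs) else 0) (indices n (d + 1))"

text \<open>
  \<open>d\<close> is the order of the result, \<open>J \<subseteq> {1..d}\<close> the set of erased positions; the argument has order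
  \<open>d - card J\<close>.
\<close>

definition forget :: "nat \<Rightarrow> nat \<Rightarrow> nat set \<Rightarrow> tensor \<Rightarrow> tensor" where
  "forget n d J T = restrict (\<lambda>xs. T (nths xs {k. Suc k \<notin> J})) (indices n d)"


section \<open>Networks\<close>

text \<open>
  The nodes in their total ordering are \<open>a 1, \<dots>, a q\<close> with \<open>q = card (pverts G)\<close>; there is at
  least one, since the source and the sink exist. An arc is a pair (tail, head).
\<close>

locale network = pair_fin_digraph G
  for G :: "'v pair_pre_digraph" +
  fixes n :: nat
    and a :: "nat \<Rightarrow> 'v"
    and A :: "'v \<Rightarrow> tensor"
  assumes nonempty: "pverts G \<noteq> {}"
    and no_oriented_cycles: "acyclic (parcs G)"
    and ordering: "bij_betw a {1..card (pverts G)} (pverts G)"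
    and compatible: "\<And>k i. \<lbrakk>k \<in> {1..card (pverts G)}; i \<in> {1..card (pverts G)};
                        (a k, a i) \<in> parcs G\<rbrakk> \<Longrightarrow> k < i"
    and activation: "\<And>v. v \<in> pverts G \<Longrightarrow> A v \<in> tensors n (in_degree (with_proj G) v + 1)"

definition parents :: "'v pair_pre_digraph \<Rightarrow> (nat \<Rightarrow> 'v) \<Rightarrow> nat \<Rightarrow> nat set" where
  "parents G a i = {k \<in> {1..card (pverts G)}. (a k, a i) \<in> parcs G}"

definition total_tensor ::
    "'v pair_pre_digraph \<Rightarrow> nat \<Rightarrow> (nat \<Rightarrow> 'v) \<Rightarrow> ('v \<Rightarrow> tensor) \<Rightarrow> tensor" where
  "total_tensor G n a A =
     restrict
       (\<lambda>xs. \<Prod>j = 1..card (pverts G).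
          A (a j) (map (\<lambda>k. xs ! (k - 1)) (sorted_list_of_set (parents G a j)) @ [xs ! (j - 1)]))
       (indices n (card (pverts G)))"

definition expansion ::
    "'v pair_pre_digraph \<Rightarrow> nat \<Rightarrow> (nat \<Rightarrow> 'v) \<Rightarrow> ('v \<Rightarrow> tensor) \<Rightarrow> nat \<Rightarrow> tensor" where
  "expansion G n a A i =
     (let q = card (pverts G);
          A' = (if i > 1 then forget n i ({1..i - 1} - parents G a i) (A (a i)) else A (a i));
          A'' = (if i \<noteq> q then blow n i A' else A')
      in forget n q {i + 2..q} A'')"

end

theory Submission
  imports Defs
begin

text \<open>
  The blow is a Kronecker delta. In the factor \<open>T\<^sub>k\<close> with \<open>k < q\<close>, the summation variable \<open>h\<close> of the
  Bhattacharya--Mesner product sits in position \<open>k + 1\<close>, which is exactly the position that the blow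
  compares with position 1; the last forget erases everything beyond it. So \<open>T\<^sub>k\<close> contributes
  \<open>A'\<^sub>k(i\<^sub>1, \<dots>, i\<^sub>k)\<close> if \<open>h = i\<^sub>1\<close>, and \<open>0\<close> otherwise (\<open>forget_blow_update\<close>). As soon as there is one
  such factor, that is for \<open>q \<ge> 2\<close>, the sum over \<open>h\<close> collapses to the single term \<open>h = i\<^sub>1\<close>. In this
  term the replacement of the first index of \<open>T\<^sub>q\<close> by \<open>h\<close> changes nothing, so that \<open>T\<^sub>q\<close> contributes
  \<open>A'\<^sub>q(i\<^sub>1, \<dots>, i\<^sub>q)\<close> and the product is \<open>\<Prod>\<^sub>k A'\<^sub>k(i\<^sub>1, \<dots>, i\<^sub>k)\<close>
  (\<open>bmp_blown\<close>). For \<open>q = 1\<close> there is no sum and nothing to collapse.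

  This is the total tensor, because the first forget, which erases the non-parents among
  \<open>1, \<dots>, k - 1\<close>, leaves precisely the states of the parents in increasing order followed by the
  state of the node itself (\<open>nths_parents\<close>).
\<close>

lemma nths_conv_map_sorted_list_of_set:
  "nths xs I = map ((!) xs) (sorted_list_of_set {k \<in> I. k < length xs})"
proof -
  have zip: "zip xs [0..<length xs] = map (\<lambda>k. (xs ! k, k)) [0..<length xs]"
    by (rule nth_equalityI) simp_all
  have "nths xs I = map ((!) xs) (filter (\<lambda>k. k \<in> I) [0..<length xs])"
    by (simp add: nths_def zip filter_map o_def)
  also have "filter (\<lambda>k. k \<in> I) [0..<length xs] = sorted_list_of_set {k \<in> I. k < length xs}"
    by (rule sorted_distinct_set_unique) (auto simp: sorted_wrt_filter)
  finally show ?thesis .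
qed

lemma sorted_list_of_set_image_Suc:
  assumes "finite S"
  shows "sorted_list_of_set (Suc ` S) = map Suc (sorted_list_of_set S)"
  using assms
  by (intro sorted_distinct_set_unique) (auto simp: sorted_map distinct_map)

text \<open>
  Erasing the non-parents before node \<open>i\<close> turns a state of the first \<open>i\<close> nodes into the argument of
  the activation tensor of node \<open>i\<close>. The shift by \<open>Suc\<close> translates between node numbers, which start
  at 1, and list positions, which start at 0.
\<close>

lemma nths_parents:
  assumes P: "P \<subseteq> {1..<i}" and i: "0 < i" "i \<le> length xs"
  shows "nths (take i xs) {k. Suc k \<notin> {1..i - 1} - P} =
           map (\<lambda>k. xs ! (k - 1)) (sorted_list_of_set P) @ [xs ! (i - 1)]"
proof -
  define S where "S = {k. Suc k \<in> P}"
  have PS: "P = Suc ` S"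
  proof
    show "P \<subseteq> Suc ` S"
    proof
      fix p assume "p \<in> P"
      with P show "p \<in> Suc ` S"
        by (intro image_eqI[of _ _ "p - 1"]) (auto simp: S_def)
    qed
  qed (auto simp: S_def)
  have S: "S \<subseteq> {..<i - 1}" using P by (auto simp: S_def)
  then have fin: "finite S" using finite_subset by blast
  have kept: "{k \<in> {k. Suc k \<notin> {1..i - 1} - P}. k < length (take i xs)} = insert (i - 1) S"
    using i S P by (auto simp: S_def)
  have sorted: "sorted_list_of_set (insert (i - 1) S) = sorted_list_of_set S @ [i - 1]"
    using fin S
    by (intro sorted_distinct_set_unique)
      (auto simp: sorted_append less_imp_le simp del: sorted_list_of_set_insert_remove)
  have "nths (take i xs) {k. Suc k \<notin> {1..i - 1} - P} =
          map ((!) (take i xs)) (sorted_list_of_set S @ [i - 1])"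
    by (simp only: nths_conv_map_sorted_list_of_set kept sorted)
  also have "\<dots> = map ((!) xs) (sorted_list_of_set S @ [i - 1])"
    using fin S i by auto
  also have "\<dots> = map (\<lambda>k. xs ! (k - 1)) (sorted_list_of_set P) @ [xs ! (i - 1)]"
    by (simp add: PS sorted_list_of_set_image_Suc[OF fin])
  finally show ?thesis .
qed

lemma take_in_indices:
  assumes "xs \<in> indices n q" "i \<le> q"
  shows "take i xs \<in> indices n i"
  using assms subset_trans[OF set_take_subset[of i xs]] by (simp add: indices_def)

lemma update_in_indices:
  assumes "xs \<in> indices n q" "h < n"
  shows "xs[i := h] \<in> indices n q"
  using assms subset_trans[OF set_update_subset_insert[of xs i h]] by (simp add: indices_def)

lemma forget_tail:
  assumes "xs \<in> indices n q"
  shows "forget n q {Suc m..q} T xs = T (take m xs)"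
proof -
  have "{k \<in> {k. Suc k \<notin> {Suc m..q}}. k < length xs} = {k \<in> {..<m}. k < length xs}"
    using assms by (auto simp: indices_def)
  then have "nths xs {k. Suc k \<notin> {Suc m..q}} = nths xs {..<m}"
    by (simp only: nths_conv_map_sorted_list_of_set)
  then show ?thesis using assms by (simp add: forget_def)
qed

text \<open>
  The index that a Bhattacharya--Mesner product sums over meets the delta of the blow, because
  position \<open>i + 1\<close> (list position \<open>i\<close>) is the last one that survives the forget.
\<close>

lemma forget_blow_update:
  assumes "xs \<in> indices n q" "h < n" "0 < i" "i < q"
  shows "forget n q {i + 2..q} (blow n i B) (xs[i := h]) =
           (if h = xs ! 0 then B (take i xs) else 0)"
proof -
  have upd: "xs[i := h] \<in> indices n q"
    using assms update_in_indices by blast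
  have len: "length xs = q" using assms by (simp add: indices_def)
  have "take (Suc i) (xs[i := h]) \<in> indices n (i + 1)"
    using take_in_indices[OF upd] assms by simp
  then show ?thesis
    using forget_tail[OF upd, of "Suc i"] assms len by (auto simp: blow_def min_def)
qed

text \<open>
  All blown factors carry the same delta, so they agree on the one term \<open>h = xs ! 0\<close> that survives
  in the sum. The bound on \<open>d\<close> guarantees that there is a blown factor at all. The factor \<open>T d\<close>
  carries no delta, but in the surviving term its index \<open>xs[0 := h]\<close> is \<open>xs\<close> itself.
\<close>

lemma bmp_blown:
  assumes d: "2 \<le> d" and xs: "xs \<in> indices n d"
    and blown: "\<And>k. \<lbrakk>0 < k; k < d\<rbrakk> \<Longrightarrow> T k = forget n d {k + 2..d} (blow n k (B k))"
    and last: "T d xs = B d xs"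
  shows "bmp n d T xs = (\<Prod>k = 1..d. B k (take k xs))"
proof -
  have len: "length xs = d" and x0: "xs ! 0 < n"
    using xs d by (auto simp: indices_def subset_iff)
  have factor: "T k (xs[k := h]) = (if h = xs ! 0 then B k (take k xs) else 0)"
    if "h < n" "k \<in> {1..d - 1}" for h k
    using that blown forget_blow_update[OF xs] by auto
  have "T d (xs[0 := h]) * (\<Prod>k = 1..d - 1. T k (xs[k := h])) =
          (if h = xs ! 0 then B d xs * (\<Prod>k = 1..d - 1. B k (take k xs)) else 0)"
    if h: "h < n" for h
  proof (cases "h = xs ! 0")
    case True
    then show ?thesis using factor[OF h] last by simp
  next
    case False
    have "\<exists>k\<in>{1..d - 1}. T k (xs[k := h]) = 0"
      using factor[OF h, of 1] False d by (intro bexI[of _ 1]) auto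
    then show ?thesis using False by (simp add: prod_zero_iff del: atLeastAtMost_iff)
  qed
  then have "bmp n d T xs =
      (\<Sum>h<n. if h = xs ! 0 then B d xs * (\<Prod>k = 1..d - 1. B k (take k xs)) else 0)"
    using d xs by (simp add: bmp_def)
  also have "\<dots> = B d (take d xs) * (\<Prod>k = 1..d - 1. B k (take k xs))"
    using x0 len by simp
  also have "\<dots> = (\<Prod>k = 1..d. B k (take k xs))"
    using d by (cases d) (simp_all add: mult.commute)
  finally show ?thesis .
qed

lemma (in network) parents_subset:
  assumes "i \<in> {1..card (pverts G)}"
  shows "parents G a i \<subseteq> {1..<i}"
  using assms compatible by (auto simp: parents_def)

theorem theorem25:
  fixes G :: "'v pair_pre_digraph"
    and n q :: nat
    and a :: "nat \<Rightarrow> 'v"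
    and A :: "'v \<Rightarrow> tensor"
  assumes "network G n a A"
    and "q = card (pverts G)"
  shows "bmp n q (expansion G n a A) = total_tensor G n a A"
proof -
  interpret network G n a A by fact
  define P where "P = parents G a"
  define A' where
    "A' i = (if i > 1 then forget n i ({1..i - 1} - P i) (A (a i)) else A (a i))" for i
  have q: "0 < q"
    using nonempty finite_verts assms(2) by (simp add: card_gt_0_iff)
  have P: "P i \<subseteq> {1..<i}" if "i \<in> {1..q}" for i
    using parents_subset that assms(2) by (simp add: P_def)
  have A': "A' i (take i xs) =
      A (a i) (map (\<lambda>k. xs ! (k - 1)) (sorted_list_of_set (P i)) @ [xs ! (i - 1)])"
    if i: "i \<in> {1..q}" and xs: "xs \<in> indices n q" for i xs
  proof (cases "i = 1")
    case True
    then have "P i = {}" using P[OF i] by auto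
    moreover have "take 1 xs = [xs ! 0]"
      using xs q by (cases xs) (auto simp: indices_def)
    ultimately show ?thesis using True by (simp add: A'_def)
  next
    case False
    then have "1 < i" using i by auto
    moreover have "take i xs \<in> indices n i" using take_in_indices[OF xs] i by simp
    moreover have "i \<le> length xs" using i xs by (simp add: indices_def)
    ultimately show ?thesis
      using nths_parents[OF P[OF i], of xs] by (simp add: A'_def forget_def)
  qed
  have interior: "expansion G n a A i = forget n q {i + 2..q} (blow n i (A' i))"
    if "i < q" for i
    using that assms(2) by (simp add: expansion_def A'_def P_def Let_def)
  have sink: "expansion G n a A q = forget n q {Suc q..q} (A' q)"
    using assms(2) by (simp add: expansion_def A'_def P_def Let_def)
  have sink_at: "expansion G n a A q xs = A' q xs" if "xs \<in> indices n q" for xs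
    using forget_tail[OF that, of q] that unfolding sink by (simp add: indices_def)
  have product: "bmp n q (expansion G n a A) xs = (\<Prod>i = 1..q. A' i (take i xs))"
    if xs: "xs \<in> indices n q" for xs
  proof (cases "q = 1")
    case True
    then show ?thesis using sink_at[OF xs] xs by (simp add: bmp_def indices_def)
  next
    case False
    then show ?thesis
      using q xs interior sink_at[OF xs] by (intro bmp_blown) auto
  qed
  show ?thesis
  proof
    fix xs
    show "bmp n q (expansion G n a A) xs = total_tensor G n a A xs"
    proof (cases "xs \<in> indices n q")
      case True
      then show ?thesis
        using product[OF True] A'[OF _ True] assms(2) by (simp add: total_tensor_def P_def)
    next
      case False
      \<comment> \<open>Outside the index set both sides are \<open>undefined\<close>; for \<open>q = 1\<close> the restriction comes from
        the last forget, not from the product.\<close>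
      then have "bmp n q (expansion G n a A) xs = undefined"
        using sink by (cases "q = 1") (simp_all add: bmp_def forget_def)
      then show ?thesis using False assms(2) by (simp add: total_tensor_def)
    qed
  qed
qed

end
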